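(* Let $(H,\circ)$ be a hypersemigroup and let $f$ be a fuzzy subset of $H$. Then $f$ is a fuzzy bi-ideal of $H$ if and only if $f\circ 1\circ f\preceq f$.
   Context: A hypergroupoid $(H,\circ)$ is a nonempty set $H$ with a map $\circ: H\times H\to \mathcal{P}^*(H)$, $(a,b)\mapsto a\circ b$, where $\mathcal{P}^*(H)$ is the set of nonempty subsets of $H$. For $A,B\in\mathcal{P}^*(H)$ put $A*B:=\bigcup_{(a,b)\in A\times B}(a\circ b)$. A hypergroupoid $H$ is a hypersemigroup if $(x\circ y)*\{z\}=\{x\}*(y\circ z)$ for all $x,y,z\in H$. A fuzzy subset of $H$ is a map $f:H\to[0,1]$ into the real unit interval. For $a\in H$ put $A_a:=\{(y,z)\in H\times H \mid a\in y\circ z\}$. For fuzzy subsets $f,g$ of $H$, the fuzzy subset $f\circ g$ is defined by $(f\circ g)(a):=\bigvee_{(y,z)\in A_a}\min\{f(y),g(z)\}$ (supremum) if $A_a\neq\emptyset$, and $(f\circ g)(a):=0$ if $A_a=\emptyset$. When $H$ is a hypersemigroup this product of fuzzy subsets is associative, and $f\circ g\circ h$ denotes $(f\circ g)\circ h=f\circ(g\circ h)$. The order on fuzzy subsets is $f\preceq g$ if and only if $f(x)\le g(x)$ for every $x\in H$. The symbol $1$ denotes the constant fuzzy subset $1(x):=1$ for all $x\in H$. A fuzzy subset $f$ of a hypersemigroup $H$ is called a fuzzy bi-ideal of $H$ if for all $x,y,z\in H$ and all $u\in(x\circ y)*\{z\}$ one has $f(u)\ge\min\{f(x),f(z)\}$.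 *)

theory Defs
  imports Complex_Main
begin

text \<open>The hyperoperation is a HOL-total function \<open>op\<close>; only its values on the carrier \<open>H\<close> are
  constrained. Likewise a fuzzy subset of \<open>H\<close> is a real function of which only the restriction
  to \<open>H\<close> matters.\<close>

definition hypergroupoid :: "'a set \<Rightarrow> ('a \<Rightarrow> 'a \<Rightarrow> 'a set) \<Rightarrow> bool" where
  "hypergroupoid H op \<longleftrightarrow> H \<noteq> {} \<and> (\<forall>a\<in>H. \<forall>b\<in>H. op a b \<noteq> {} \<and> op a b \<subseteq> H)"

definition hset_prod :: "('a \<Rightarrow> 'a \<Rightarrow> 'a set) \<Rightarrow> 'a set \<Rightarrow> 'a set \<Rightarrow> 'a set" where
  "hset_prod op A B = (\<Union>(a, b)\<in>A \<times> B. op a b)"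

definition hypersemigroup :: "'a set \<Rightarrow> ('a \<Rightarrow> 'a \<Rightarrow> 'a set) \<Rightarrow> bool" where
  "hypersemigroup H op \<longleftrightarrow> hypergroupoid H op \<and>
     (\<forall>x\<in>H. \<forall>y\<in>H. \<forall>z\<in>H. hset_prod op (op x y) {z} = hset_prod op {x} (op y z))"

definition fuzzy_subset :: "'a set \<Rightarrow> ('a \<Rightarrow> real) \<Rightarrow> bool" where
  "fuzzy_subset H f \<longleftrightarrow> (\<forall>x\<in>H. f x \<in> {0..1})"

definition hfactors :: "'a set \<Rightarrow> ('a \<Rightarrow> 'a \<Rightarrow> 'a set) \<Rightarrow> 'a \<Rightarrow> ('a \<times> 'a) set" where
  "hfactors H op a = {(y, z) \<in> H \<times> H. a \<in> op y z}"

text \<open>The supremum is taken in the reals; for fuzzy subsets the family is bounded above by 1,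
  so it is the supremum in \<open>[0, 1]\<close>.\<close>

definition fuzzy_prod ::
  "'a set \<Rightarrow> ('a \<Rightarrow> 'a \<Rightarrow> 'a set) \<Rightarrow> ('a \<Rightarrow> real) \<Rightarrow> ('a \<Rightarrow> real) \<Rightarrow> 'a \<Rightarrow> real" where
  "fuzzy_prod H op f g a =
     (if hfactors H op a \<noteq> {} then (SUP (y, z)\<in>hfactors H op a. min (f y) (g z)) else 0)"

definition fuzzy_le :: "'a set \<Rightarrow> ('a \<Rightarrow> real) \<Rightarrow> ('a \<Rightarrow> real) \<Rightarrow> bool" where
  "fuzzy_le H f g \<longleftrightarrow> (\<forall>x\<in>H. f x \<le> g x)"

definition fuzzy_one :: "'a \<Rightarrow> real" where
  "fuzzy_one x = 1"

definition fuzzy_bi_ideal :: "'a set \<Rightarrow> ('a \<Rightarrow> 'a \<Rightarrow> 'a set) \<Rightarrow> ('a \<Rightarrow> real) \<Rightarrow> bool" where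
  "fuzzy_bi_ideal H op f \<longleftrightarrow> fuzzy_subset H f \<and>
     (\<forall>x\<in>H. \<forall>y\<in>H. \<forall>z\<in>H. \<forall>u\<in>hset_prod op (op x y) {z}. f u \<ge> min (f x) (f z))"

text \<open>Associativity, so that an unbracketed triple product is unambiguous.\<close>

lemma less_fuzzy_prod_iff:
  assumes f: "fuzzy_subset H f" and g: "fuzzy_subset H g" and t: "0 \<le> t"
  shows "t < fuzzy_prod H op f g a \<longleftrightarrow>
    (\<exists>y\<in>H. \<exists>z\<in>H. a \<in> op y z \<and> t < f y \<and> t < g z)"
proof (cases "hfactors H op a = {}")
  case True
  then show ?thesis using t by (auto simp: fuzzy_prod_def hfactors_def)
next
  case False
  have "bdd_above ((\<lambda>(y, z). min (f y) (g z)) ` hfactors H op a)"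
    using f by (intro bdd_aboveI[of _ 1]) (auto simp: hfactors_def fuzzy_subset_def min_le_iff_disj)
  then show ?thesis using False
    by (subst fuzzy_prod_def) (auto simp: less_cSUP_iff hfactors_def)
qed

lemma fuzzy_subset_prod:
  assumes f: "fuzzy_subset H f" and g: "fuzzy_subset H g"
  shows "fuzzy_subset H (fuzzy_prod H op f g)" and "0 \<le> fuzzy_prod H op f g a"
proof -
  have le1: "fuzzy_prod H op f g b \<le> 1" for b
    using less_fuzzy_prod_iff[OF f g, of 1] f unfolding fuzzy_subset_def
    by (meson atLeastAtMost_iff less_eq_real_def linorder_not_less zero_le_one)
  have ge0: "0 \<le> fuzzy_prod H op f g b" for b
  proof (cases "hfactors H op b = {}")
    case True
    then show ?thesis by (simp add: fuzzy_prod_def)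
  next
    case False
    then obtain y z where yz: "(y, z) \<in> hfactors H op b" by auto
    have "bdd_above ((\<lambda>(y, z). min (f y) (g z)) ` hfactors H op b)"
      using f by (intro bdd_aboveI[of _ 1]) (auto simp: hfactors_def fuzzy_subset_def min_le_iff_disj)
    from cSUP_upper[OF yz this] have "min (f y) (g z) \<le> fuzzy_prod H op f g b"
      using False by (simp add: fuzzy_prod_def)
    moreover have "0 \<le> min (f y) (g z)"
      using yz f g by (auto simp: hfactors_def fuzzy_subset_def)
    ultimately show ?thesis by linarith
  qed
  show "fuzzy_subset H (fuzzy_prod H op f g)" "0 \<le> fuzzy_prod H op f g a"
    using le1 ge0 by (auto simp: fuzzy_subset_def)
qed

lemma fuzzy_prod_assoc:
  assumes H: "hypersemigroup H op"
    and f: "fuzzy_subset H f" and g: "fuzzy_subset H g" and h: "fuzzy_subset H h"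
  shows "fuzzy_prod H op (fuzzy_prod H op f g) h = fuzzy_prod H op f (fuzzy_prod H op g h)"
proof
  fix a
  let ?L = "fuzzy_prod H op (fuzzy_prod H op f g) h a"
  let ?R = "fuzzy_prod H op f (fuzzy_prod H op g h) a"
  note fg = fuzzy_subset_prod(1)[OF f g, of op] and gh = fuzzy_subset_prod(1)[OF g h, of op]
  have sub: "b \<in> H" if "x \<in> H" "y \<in> H" "b \<in> op x y" for x y b
    using H that by (auto simp: hypersemigroup_def hypergroupoid_def)
  have assoc: "(\<exists>b\<in>op x y. a \<in> op b z) \<longleftrightarrow> (\<exists>b\<in>op y z. a \<in> op x b)"
    if "x \<in> H" "y \<in> H" "z \<in> H" for x y z
  proof -
    have "hset_prod op (op x y) {z} = hset_prod op {x} (op y z)"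
      using H that by (simp add: hypersemigroup_def)
    then have "a \<in> hset_prod op (op x y) {z} \<longleftrightarrow> a \<in> hset_prod op {x} (op y z)" by simp
    then show ?thesis by (simp add: hset_prod_def)
  qed
  have cut: "t < ?L \<longleftrightarrow> t < ?R" if t: "0 \<le> t" for t
  proof -
    have "t < ?L \<longleftrightarrow> (\<exists>x\<in>H. \<exists>y\<in>H. \<exists>z\<in>H. (\<exists>b\<in>op x y. a \<in> op b z) \<and> t < f x \<and> t < g y \<and> t < h z)"
      unfolding less_fuzzy_prod_iff[OF fg h t] less_fuzzy_prod_iff[OF f g t] using sub by blast
    also have "\<dots> \<longleftrightarrow> (\<exists>x\<in>H. \<exists>y\<in>H. \<exists>z\<in>H. (\<exists>b\<in>op y z. a \<in> op x b) \<and> t < f x \<and> t < g y \<and> t < h z)"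
      using assoc by blast
    also have "\<dots> \<longleftrightarrow> t < ?R"
      unfolding less_fuzzy_prod_iff[OF f gh t] less_fuzzy_prod_iff[OF g h t] using sub by blast
    finally show ?thesis .
  qed
  have "0 \<le> ?L" "0 \<le> ?R"
    using fuzzy_subset_prod(2)[OF fg h] fuzzy_subset_prod(2)[OF f gh] by auto
  then show "?L = ?R" using cut[of ?L] cut[of ?R] by linarith
qed

end

theory Submission
  imports Defs
begin

text \<open>Both sides are compared through strict cuts: for \<open>t \<ge> 0\<close>, the value of \<open>f \<circ> 1 \<circ> f\<close> at \<open>u\<close>
  exceeds \<open>t\<close> iff \<open>u\<close> lies in some \<open>(x \<circ> y) * {z}\<close> with \<open>f x > t\<close> and \<open>f z > t\<close>. Taking
  \<open>t = f u\<close>, a failure of \<open>f \<circ> 1 \<circ> f \<preceq> f\<close> at \<open>u\<close> is the same as a failure of the bi-ideal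
  inequality at \<open>u\<close>.\<close>

lemma fuzzy_subset_one: "fuzzy_subset H fuzzy_one"
  by (simp add: fuzzy_subset_def fuzzy_one_def)

lemma hset_prod_subset:
  assumes "hypergroupoid H op" "A \<subseteq> H" "B \<subseteq> H"
  shows "hset_prod op A B \<subseteq> H"
  using assms by (fastforce simp: hypergroupoid_def hset_prod_def)

lemma less_fuzzy_prod_one_iff:
  assumes H: "hypergroupoid H op" and f: "fuzzy_subset H f" and g: "fuzzy_subset H g"
    and t: "0 \<le> t"
  shows "t < fuzzy_prod H op (fuzzy_prod H op f fuzzy_one) g u \<longleftrightarrow>
    (\<exists>x\<in>H. \<exists>y\<in>H. \<exists>z\<in>H. u \<in> hset_prod op (op x y) {z} \<and> t < min (f x) (g z))"
proof -
  note f1 = fuzzy_subset_prod(1)[OF f fuzzy_subset_one, of op]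
  \<comment> \<open>The middle factor \<open>fuzzy_one\<close> leaves the condition
    \<open>t < 1\<close> in the cut; the bound \<open>f x \<le> 1\<close> derives it from
    \<open>t < f x\<close>.\<close>
  have lt1: "t < 1" if "x \<in> H" "t < f x" for x
    using f that by (fastforce simp: fuzzy_subset_def)
  have closed: "b \<in> H" if "x \<in> H" "y \<in> H" "b \<in> op x y" for x y b
    using H that by (auto simp: hypergroupoid_def)
  have mem: "u \<in> hset_prod op (op x y) {z} \<longleftrightarrow> (\<exists>b\<in>op x y. u \<in> op b z)" for x y z
    by (simp add: hset_prod_def)
  show ?thesis
    unfolding less_fuzzy_prod_iff[OF f1 g t] less_fuzzy_prod_iff[OF f fuzzy_subset_one t]
      mem min_less_iff_conj fuzzy_one_def
    by (meson lt1 closed)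
qed

theorem theorem11:
  fixes H :: "'a set" and op :: "'a \<Rightarrow> 'a \<Rightarrow> 'a set" and f :: "'a \<Rightarrow> real"
  assumes "hypersemigroup H op" and "fuzzy_subset H f"
  shows "fuzzy_bi_ideal H op f \<longleftrightarrow>
    fuzzy_le H (fuzzy_prod H op (fuzzy_prod H op f fuzzy_one) f) f"
proof -
  have H: "hypergroupoid H op"
    using assms(1) by (simp add: hypersemigroup_def)
  \<comment> \<open>The level \<open>t = f u\<close> is admissible because \<open>f\<close> is
    nonnegative on \<open>H\<close>.\<close>
  have cut: "f u < fuzzy_prod H op (fuzzy_prod H op f fuzzy_one) f u \<longleftrightarrow>
      (\<exists>x\<in>H. \<exists>y\<in>H. \<exists>z\<in>H. u \<in> hset_prod op (op x y) {z} \<and> f u < min (f x) (f z))"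
    if "u \<in> H" for u
    using less_fuzzy_prod_one_iff[OF H assms(2) assms(2)] assms(2) that
    by (simp add: fuzzy_subset_def)
  \<comment> \<open>The bi-ideal condition takes \<open>u\<close> from a triple product,
    \<open>fuzzy_le\<close> from \<open>H\<close>; closure reconciles the two ranges.\<close>
  have closed: "u \<in> H"
    if "x \<in> H" "y \<in> H" "z \<in> H" "u \<in> hset_prod op (op x y) {z}" for x y z u
  proof -
    have "op x y \<subseteq> H"
      using H that by (simp add: hypergroupoid_def)
    then show ?thesis
      using hset_prod_subset[OF H, of "op x y" "{z}"] that by blast
  qed
  have "fuzzy_bi_ideal H op f \<longleftrightarrow> (\<forall>u\<in>H. \<not> (\<exists>x\<in>H. \<exists>y\<in>H. \<exists>z\<in>H.
      u \<in> hset_prod op (op x y) {z} \<and> f u < min (f x) (f z)))"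
    using assms(2) unfolding fuzzy_bi_ideal_def linorder_not_less[symmetric]
    by (meson closed)
  also have "\<dots> \<longleftrightarrow> fuzzy_le H (fuzzy_prod H op (fuzzy_prod H op f fuzzy_one) f) f"
    unfolding fuzzy_le_def linorder_not_less[symmetric] by (simp add: cut)
  finally show ?thesis .
qed

end
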